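(* Let $d\ge3$ and for complex $\lambda$ let $\mu_{1,2}(\lambda)=\frac{\lambda\pm\sqrt{\lambda^2-4(d-1)}}{2}$ and $\tilde q_k(\lambda)=\mu_1(\lambda)^k+\mu_2(\lambda)^k+\bigl(1+(-1)^k\bigr)(d-2)/2$. If $G$ is a finite $d$-regular graph with no half-loops and adjacency eigenvalues $\lambda_1,\dots,\lambda_n$, then for every integer $k\ge1$, $\mathrm{SIT}(G,k)=\sum_{i=1}^n\tilde q_k(\lambda_i)$. If instead $G$ has no whole-loops, the same holds with $\tilde q_k$ replaced by $\hat q_k$, where $\hat q_k(x)=\tilde q_k(x)$ if $k$ is even or $k=1$, and $\hat q_k(x)=\tilde q_k(x)-x$ if $k\ge3$ is odd.
   Context: Graphs have directed edges with an involution "reverse" (opp); multiple edges allowed; a whole-loop is a pair of distinct directed self-loops that are each other's reverse (contributing $2$ to the degree and the adjacency diagonal), a half-loop is a directed self-loop that is its own reverse (contributing $1$). A closed walk of length $k$ is a sequence of directed edges $e_1,\dots,e_k$ with $e_i$ terminating at the origin of $e_{i+1}$ and $e_k$ terminating at the origin of $e_1$. It is strongly irreducible if $e_{i+1}\ne\mathrm{opp}(e_i)$ for $1\le i<k$ and $e_1\neq\mathrm{opp}(e_k)$. $\mathrm{SIT}(G,k)$ is the number of strongly irreducible closed walks of length $k$ in $G$, with the convention that each half-loop is also counted as a strongly irreducible closed walk of length $1$. *)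

theory Defs
  imports "Graph_Theory.Arc_Walk" "Jordan_Normal_Form.Char_Poly"
begin

text \<open>
  Every edge is represented by its directed arcs; \<open>opp\<close> maps an arc to its reverse.
  The locale \<open>bidirected_digraph\<close> of the library is not usable here, because it requires
  \<open>opp e \<noteq> e\<close> for all arcs and hence excludes half-loops.
\<close>

locale finite_opp_graph = fin_digraph G for G :: "('v, 'e) pre_digraph" +
  fixes opp :: "'e \<Rightarrow> 'e"
  assumes opp_in_arcs: "e \<in> arcs G \<Longrightarrow> opp e \<in> arcs G"
    and opp_opp: "e \<in> arcs G \<Longrightarrow> opp (opp e) = e"
    and tail_opp: "e \<in> arcs G \<Longrightarrow> tail G (opp e) = head G e"
    and head_opp: "e \<in> arcs G \<Longrightarrow> head G (opp e) = tail G e"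

definition half_loops :: "('v, 'e) pre_digraph \<Rightarrow> ('e \<Rightarrow> 'e) \<Rightarrow> 'e set" where
  "half_loops G opp = {e \<in> arcs G. tail G e = head G e \<and> opp e = e}"

text \<open>Both arcs of every whole-loop belong to the following set.\<close>

definition whole_loop_arcs :: "('v, 'e) pre_digraph \<Rightarrow> ('e \<Rightarrow> 'e) \<Rightarrow> 'e set" where
  "whole_loop_arcs G opp = {e \<in> arcs G. tail G e = head G e \<and> opp e \<noteq> e}"

text \<open>
  The degree of a vertex is its out-degree, so that a half-loop contributes 1 and a whole-loop
  contributes 2.
\<close>

definition regular_graph :: "nat \<Rightarrow> ('v, 'e) pre_digraph \<Rightarrow> bool" where
  "regular_graph d G \<longleftrightarrow> (\<forall>v \<in> verts G. out_degree G v = d)"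

text \<open>The list \<open>vs\<close> is an enumeration of the vertices, which fixes the order of rows and columns.\<close>

definition adjacency_matrix :: "('v, 'e) pre_digraph \<Rightarrow> 'v list \<Rightarrow> complex mat" where
  "adjacency_matrix G vs = mat (length vs) (length vs)
     (\<lambda>(i, j). of_nat (card {e \<in> arcs G. tail G e = vs ! i \<and> head G e = vs ! j}))"

text \<open>
  The complex numbers \<open>ls\<close> are the eigenvalues of \<open>A\<close>, listed with (algebraic) multiplicity.
\<close>

definition eigenvalue_list :: "complex mat \<Rightarrow> complex list \<Rightarrow> bool" where
  "eigenvalue_list A ls \<longleftrightarrow> char_poly A = (\<Prod>l\<leftarrow>ls. [:- l, 1:])"

definition strongly_irreducible :: "('e \<Rightarrow> 'e) \<Rightarrow> 'e list \<Rightarrow> bool" where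
  "strongly_irreducible opp p \<longleftrightarrow>
     (\<forall>i. Suc i < length p \<longrightarrow> p ! Suc i \<noteq> opp (p ! i)) \<and> hd p \<noteq> opp (last p)"

text \<open>
  A half-loop \<open>e\<close>, as the walk \<open>[e]\<close>, violates the cyclic condition \<open>e \<noteq> opp e\<close>; by convention it
  is nevertheless counted as a strongly irreducible closed walk of length 1.
\<close>

definition SIT :: "('v, 'e) pre_digraph \<Rightarrow> ('e \<Rightarrow> 'e) \<Rightarrow> nat \<Rightarrow> nat" where
  "SIT G opp k = card {p. wf_digraph.closed_w G p \<and> length p = k \<and>
     (strongly_irreducible opp p \<or> (\<exists>e \<in> half_loops G opp. p = [e]))}"

definition mu1 :: "nat \<Rightarrow> complex \<Rightarrow> complex" where
  "mu1 d x = (x + csqrt (x\<^sup>2 - 4 * (of_nat d - 1))) / 2"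

definition mu2 :: "nat \<Rightarrow> complex \<Rightarrow> complex" where
  "mu2 d x = (x - csqrt (x\<^sup>2 - 4 * (of_nat d - 1))) / 2"

definition q_tilde :: "nat \<Rightarrow> nat \<Rightarrow> complex \<Rightarrow> complex" where
  "q_tilde d k x = mu1 d x ^ k + mu2 d x ^ k + (1 + (- 1) ^ k) * (of_nat d - 2) / 2"

definition q_hat :: "nat \<Rightarrow> nat \<Rightarrow> complex \<Rightarrow> complex" where
  "q_hat d k x = (if even k \<or> k = 1 then q_tilde d k x else q_tilde d k x - x)"

end

theory Submission
  imports Defs "Jordan_Normal_Form.Schur_Decomposition"
begin

text \<open>
  The strongly irreducible closed walks of length \<open>k\<close> are counted by the trace of \<open>B ^ k\<close>, where
  \<open>B\<close> is the non-backtracking matrix on the arcs. It factors as \<open>B = S * T - J\<close>, where \<open>S\<close> and \<open>T\<close>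
  are the incidence matrices of heads and tails and \<open>J\<close> is the permutation matrix of \<open>opp\<close>. Then
  \<open>T * S\<close> is the adjacency matrix \<open>A\<close>, and \<open>T * J * S = d\<close> by regularity. These relations
  express \<open>trace (B ^ (k + 2)) - trace (B ^ k)\<close> as the trace of a polynomial in \<open>A\<close>, which is
  the difference of the power sums \<open>\<mu>\<^sub>1 ^ k + \<mu>\<^sub>2 ^ k\<close> over the eigenvalues. Hence the
  trace of \<open>B ^ k\<close> deviates from the power sums by a quantity that depends only on the parity of
  \<open>k\<close>: it is \<open>n * (d - 2)\<close> for \<open>k = 0\<close> and minus the number of half-loops for \<open>k = 1\<close>.
\<close>

subsection \<open>Traces and Dickson polynomials\<close>

definition mat_trace :: "'a::comm_monoid_add mat \<Rightarrow> 'a" where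
  "mat_trace A = (\<Sum>i<dim_row A. A $$ (i, i))"

lemma mat_trace_mult_commute:
  fixes A B :: "'a::comm_semiring_0 mat"
  assumes "A \<in> carrier_mat n m" "B \<in> carrier_mat m n"
  shows "mat_trace (A * B) = mat_trace (B * A)"
proof -
  have "mat_trace (A * B) = (\<Sum>i<n. \<Sum>j<m. A $$ (i, j) * B $$ (j, i))"
    using assms by (auto simp: mat_trace_def scalar_prod_def atLeast0LessThan intro!: sum.cong)
  also have "\<dots> = (\<Sum>j<m. \<Sum>i<n. B $$ (j, i) * A $$ (i, j))"
    by (subst sum.swap) (simp add: mult.commute)
  also have "\<dots> = mat_trace (B * A)"
    using assms by (auto simp: mat_trace_def scalar_prod_def atLeast0LessThan intro!: sum.cong)
  finally show ?thesis .
qed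

lemma mat_trace_minus:
  fixes A B :: "'a::ab_group_add mat"
  assumes "A \<in> carrier_mat n n" "B \<in> carrier_mat n n"
  shows "mat_trace (A - B) = mat_trace A - mat_trace B"
  using assms by (auto simp: mat_trace_def sum_subtractf)

lemma mat_trace_one: "mat_trace (1\<^sub>m n :: 'a::semiring_1 mat) = of_nat n"
  by (simp add: mat_trace_def)

lemma pow_mat_Suc_left:
  fixes A :: "'a::semiring_1 mat"
  assumes A: "A \<in> carrier_mat n n"
  shows "A ^\<^sub>m Suc k = A * A ^\<^sub>m k"
proof (induction k)
  case 0
  then show ?case using A by simp
next
  case (Suc k)
  have "A ^\<^sub>m Suc (Suc k) = (A * A ^\<^sub>m k) * A"
    using Suc by simp
  also have "\<dots> = A * A ^\<^sub>m Suc k"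
    using A by (simp add: assoc_mult_mat[of A n n "A ^\<^sub>m k" n A n])
  finally show ?case .
qed

text \<open>A term with indices i, k, j survives only if i <= k <= j. For i = j this leaves k = i
  alone, so diagonals multiply entrywise and trace identities for triangular matrices reduce to
  scalar ones.\<close>

lemma index_mult_upper_triangular:
  fixes A B :: "'a::semiring_0 mat"
  assumes A: "A \<in> carrier_mat n n" "upper_triangular A"
    and B: "B \<in> carrier_mat n n" "upper_triangular B"
  shows "upper_triangular (A * B)"
    and "i < n \<Longrightarrow> (A * B) $$ (i, i) = A $$ (i, i) * B $$ (i, i)"
proof -
  have zA: "A $$ (i, j) = 0" and zB: "B $$ (i, j) = 0" if "i < n" "j < i" for i j
    using that A B by auto
  have entry: "(A * B) $$ (i, j) = (\<Sum>k<n. A $$ (i, k) * B $$ (k, j))" if "i < n" "j < n" for i j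
    using that A(1) B(1) by (simp add: scalar_prod_def atLeast0LessThan)
  show "upper_triangular (A * B)"
  proof
    fix i j assume "j < i" and "i < dim_row (A * B)"
    then have ij: "j < i" "i < n" using A(1) by auto
    have "A $$ (i, k) * B $$ (k, j) = 0" if "k < n" for k
      using that ij zA[of i k] zB[of k j] by (cases "k < i") auto
    then show "(A * B) $$ (i, j) = 0"
      using ij by (simp add: entry)
  qed
  assume i: "i < n"
  have "A $$ (i, k) * B $$ (k, i) = 0" if "k < n" "k \<noteq> i" for k
    using that i zA[of i k] zB[of k i] by (cases "k < i") auto
  then have "(\<Sum>k<n. A $$ (i, k) * B $$ (k, i)) = (\<Sum>k\<in>{i}. A $$ (i, k) * B $$ (k, i))"
    using i by (intro sum.mono_neutral_right) auto
  then show "(A * B) $$ (i, i) = A $$ (i, i) * B $$ (i, i)"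
    using i by (simp add: entry)
qed

text \<open>Dickson polynomial of the first kind: the k-th power sum of the roots of t^2 - x t + a,
  obtained by Newton's recurrence and so without choosing a square root.\<close>

fun dickson :: "'a::comm_ring_1 \<Rightarrow> nat \<Rightarrow> 'a \<Rightarrow> 'a" where
  "dickson a 0 x = 2"
| "dickson a (Suc 0) x = x"
| "dickson a (Suc (Suc k)) x = x * dickson a (Suc k) x - a * dickson a k x"

lemma dickson_eq_power_sum:
  "dickson (u * v) k (u + v) = u ^ k + v ^ k"
proof (induction "u * v" k "u + v" rule: dickson.induct)
  case (3 k)
  then show ?case by (simp add: algebra_simps)
qed auto

text \<open>
  The column spaces of \<open>S\<close> and \<open>J * S\<close> together span a \<open>B\<close>-invariant space, because
  \<open>B * S = S * A - J * S\<close> and \<open>B * (J * S) = (c - 1) * S\<close>; hence \<open>T * B ^ k * S\<close> is a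
  polynomial in \<open>A = T * S\<close>.
\<close>

lemma trace_pow_mat_add_2:
  fixes S T J :: "'a::comm_ring_1 mat"
  assumes S: "S \<in> carrier_mat m n" and T: "T \<in> carrier_mat n m" and J: "J \<in> carrier_mat m m"
    and JJ: "J * J = 1\<^sub>m m" and TJS: "T * (J * S) = c \<cdot>\<^sub>m 1\<^sub>m n"
    and ut: "upper_triangular (T * S)"
  defines "B \<equiv> S * T - J"
  shows "mat_trace (B ^\<^sub>m (k + 2)) - mat_trace (B ^\<^sub>m k) =
    (\<Sum>i<n. dickson (c - 1) (k + 2) ((T * S) $$ (i, i)) - dickson (c - 1) k ((T * S) $$ (i, i)))"
proof -
  note assoc_mult_mat[simp del]
  define A where "A = T * S"
  define X where "X k = T * (B ^\<^sub>m k * S)" for k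
  define Z where "Z k = T * (B ^\<^sub>m k * (J * S))" for k
  have A: "A \<in> carrier_mat n n" and B: "B \<in> carrier_mat m m"
    and JS: "J * S \<in> carrier_mat m n" and TJ: "T * J \<in> carrier_mat n m"
    and ST: "S * T \<in> carrier_mat m m"
    using S T J by (auto simp: A_def B_def)
  have Bk: "B ^\<^sub>m k \<in> carrier_mat m m" for k
    using B by simp
  have X: "X k \<in> carrier_mat n n" and Z: "Z k \<in> carrier_mat n n" for k
    using S T Bk[of k] JS by (auto simp: X_def Z_def)
  have "T * J * S = c \<cdot>\<^sub>m 1\<^sub>m n"
    using TJS assoc_mult_mat[OF T J S] by simp
  have JJS: "J * (J * S) = S"
    using assoc_mult_mat[OF J J S] JJ S by simp
  have TJJ: "T * J * J = T"
    using assoc_mult_mat[OF T J J] JJ T by simp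
  have BS: "B * S = S * A - J * S"
    unfolding B_def A_def minus_mult_distrib_mat[OF ST J S] assoc_mult_mat[OF S T S] ..
  have BJS: "B * (J * S) = (c - 1) \<cdot>\<^sub>m S"
  proof -
    have "B * (J * S) = c \<cdot>\<^sub>m S - S"
      unfolding B_def minus_mult_distrib_mat[OF ST J JS] assoc_mult_mat[OF S T JS] TJS JJS
        mult_smult_distrib[OF S one_carrier_mat]
      using S by simp
    also have "\<dots> = (c - 1) \<cdot>\<^sub>m S"
      using S by (intro eq_matI) (auto simp: algebra_simps)
    finally show ?thesis .
  qed
  \<comment> \<open>The left-hand mirror image of \<open>BJS\<close>, for the row space of
    \<open>T * J\<close>.\<close>
  have TJB: "T * J * B = (c - 1) \<cdot>\<^sub>m T"
  proof -
    have "T * J * B = c \<cdot>\<^sub>m T - T"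
      unfolding B_def mult_minus_distrib_mat[OF TJ ST J] TJJ
        assoc_mult_mat[OF TJ S T, symmetric] \<open>T * J * S = c \<cdot>\<^sub>m 1\<^sub>m n\<close>
        mult_smult_assoc_mat[OF one_carrier_mat T]
      using T by simp
    also have "\<dots> = (c - 1) \<cdot>\<^sub>m T"
      using T by (intro eq_matI) (auto simp: algebra_simps)
    finally show ?thesis .
  qed
  have B0: "B ^\<^sub>m 0 = 1\<^sub>m m" using B by simp
  have X0: "X 0 = A"
    unfolding X_def B0 left_mult_one_mat[OF S] A_def ..
  have Z0: "Z 0 = c \<cdot>\<^sub>m 1\<^sub>m n"
    unfolding Z_def B0 left_mult_one_mat[OF JS] TJS ..
  have XSuc: "X (Suc k) = X k * A - Z k" for k
  proof -
    have SA: "S * A \<in> carrier_mat m n" using S A by simp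
    note W = mult_carrier_mat[OF Bk S, of k] and V = mult_carrier_mat[OF Bk JS, of k]
    show ?thesis
      unfolding X_def Z_def pow_mat.simps assoc_mult_mat[OF Bk B S] BS
        mult_minus_distrib_mat[OF Bk SA JS] assoc_mult_mat[OF Bk S A, symmetric]
        mult_minus_distrib_mat[OF T mult_carrier_mat[OF W A] V]
        assoc_mult_mat[OF T W A] ..
  qed
  have ZSuc: "Z (Suc k) = (c - 1) \<cdot>\<^sub>m X k" for k
    unfolding X_def Z_def pow_mat.simps assoc_mult_mat[OF Bk B JS] BJS
      mult_smult_distrib[OF Bk S] mult_smult_distrib[OF T mult_carrier_mat[OF Bk S]] ..
  \<comment> \<open>Between \<open>T\<close> and \<open>S\<close>, the matrix \<open>J\<close> may
    stand on either side of the power of \<open>B\<close>: on both sides it absorbs one factor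
    \<open>B\<close> at the cost of the scalar c - 1.\<close>
  have Z': "T * J * (B ^\<^sub>m k * S) = Z k" for k
  proof (cases k)
    case 0
    show ?thesis
      unfolding 0 B0 left_mult_one_mat[OF S] Z0 by fact
  next
    case (Suc l)
    have "T * J * (B ^\<^sub>m Suc l * S) = T * J * (B * (B ^\<^sub>m l * S))"
      unfolding pow_mat_Suc_left[OF B] assoc_mult_mat[OF B Bk S] ..
    also have "\<dots> = T * J * B * (B ^\<^sub>m l * S)"
      by (rule assoc_mult_mat[OF TJ B mult_carrier_mat[OF Bk S], symmetric])
    also have "\<dots> = (c - 1) \<cdot>\<^sub>m X l"
      unfolding TJB X_def by (rule mult_smult_assoc_mat[OF T mult_carrier_mat[OF Bk S]])
    finally show ?thesis unfolding Suc ZSuc .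
  qed
  \<comment> \<open>Here B^2 = S (T B) - J B with T B = A T - T J and J B = J S T - 1. The summand
    -1, which comes from \<open>J * J\<close>, returns B^k and explains the step by 2. Cyclicity of
    the trace turns all other terms into traces of n by n matrices.\<close>
  have rec: "mat_trace (B ^\<^sub>m (k + 2)) = mat_trace (B ^\<^sub>m k) + mat_trace (A * X k) - 2 * mat_trace (Z k)"
  proof -
    have TB: "T * B = A * T - T * J"
      unfolding B_def A_def mult_minus_distrib_mat[OF T ST J] assoc_mult_mat[OF T S T] ..
    have JB: "J * B = J * S * T - 1\<^sub>m m"
      unfolding B_def mult_minus_distrib_mat[OF J ST J] assoc_mult_mat[OF J S T] JJ ..
    have TBc: "T * B \<in> carrier_mat n m" and AT: "A * T \<in> carrier_mat n m"
      and JST: "J * S * T \<in> carrier_mat m m" and JBc: "J * B \<in> carrier_mat m m"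
      using T B A JS J by auto
    have STB: "S * (T * B) \<in> carrier_mat m m" using S TBc by auto
    have W: "B ^\<^sub>m k * S \<in> carrier_mat m n" and V: "B ^\<^sub>m k * (J * S) \<in> carrier_mat m n"
      using Bk[of k] S JS by auto
    have "B * B = S * (T * B) - J * B"
      by (subst B_def, subst minus_mult_distrib_mat[OF ST J B], subst assoc_mult_mat[OF S T B]) simp
    then have "B ^\<^sub>m (k + 2) = B ^\<^sub>m k * (S * (T * B) - J * B)"
      using assoc_mult_mat[OF Bk B B, of k] by simp
    also have "\<dots> = B ^\<^sub>m k * (S * (T * B)) - B ^\<^sub>m k * (J * B)"
      by (rule mult_minus_distrib_mat[OF Bk STB JBc])
    finally have "mat_trace (B ^\<^sub>m (k + 2)) =
        mat_trace (B ^\<^sub>m k * (S * (T * B))) - mat_trace (B ^\<^sub>m k * (J * B))"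
      using Bk[of k] STB JBc by (simp add: mat_trace_minus[of _ m])
    also have "B ^\<^sub>m k * (S * (T * B)) = B ^\<^sub>m k * S * (T * B)"
      by (rule assoc_mult_mat[OF Bk S TBc, symmetric])
    also have "mat_trace \<dots> = mat_trace (T * B * (B ^\<^sub>m k * S))"
      by (rule mat_trace_mult_commute[OF W TBc])
    also have "T * B * (B ^\<^sub>m k * S) = A * X k - Z k"
      unfolding TB minus_mult_distrib_mat[OF AT TJ W] Z' assoc_mult_mat[OF A T W] X_def ..
    also have "mat_trace \<dots> = mat_trace (A * X k) - mat_trace (Z k)"
      using A X Z by (intro mat_trace_minus[of _ n]) auto
    also have "B ^\<^sub>m k * (J * B) = B ^\<^sub>m k * (J * S) * T - B ^\<^sub>m k"
      unfolding JB mult_minus_distrib_mat[OF Bk JST one_carrier_mat] assoc_mult_mat[OF Bk JS T]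
      using right_mult_one_mat[OF Bk] by simp
    also have "mat_trace \<dots> = mat_trace (B ^\<^sub>m k * (J * S) * T) - mat_trace (B ^\<^sub>m k)"
      using V T Bk[of k] by (intro mat_trace_minus[of _ m]) auto
    also have "mat_trace (B ^\<^sub>m k * (J * S) * T) = mat_trace (Z k)"
      unfolding Z_def by (rule mat_trace_mult_commute[OF V T])
    finally show ?thesis by (simp add: algebra_simps)
  qed
  have utA: "upper_triangular A" using ut by (simp add: A_def)
  have utXZ: "upper_triangular (X k) \<and> upper_triangular (Z k)" for k
  proof (induction k)
    case 0
    then show ?case using utA by (auto simp: X0 Z0)
  next
    case (Suc k)
    have "upper_triangular (X k * A)"
      using index_mult_upper_triangular(1)[OF X _ A utA] Suc by blast
    with Suc show ?case
      unfolding XSuc ZSuc using X[of k] Z[of k] A by (auto simp: upper_triangular_def)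
  qed
  have diag: "A $$ (i, i) * X k $$ (i, i) - 2 * Z k $$ (i, i) =
        dickson (c - 1) (k + 2) (A $$ (i, i)) - dickson (c - 1) k (A $$ (i, i))"
    if i: "i < n" for i
  proof -
    let ?a = "A $$ (i, i)"
    have xS: "X (Suc k) $$ (i, i) = X k $$ (i, i) * ?a - Z k $$ (i, i)" for k
      using i X[of k] Z[of k] A utXZ[of k] index_mult_upper_triangular(2)[OF X _ A utA i, of k]
      by (simp add: XSuc del: index_mult_mat(1))
    have zS: "Z (Suc k) $$ (i, i) = (c - 1) * X k $$ (i, i)" for k
      using i X[of k] by (simp add: ZSuc)
    have x0: "X 0 $$ (i, i) = ?a" and z0: "Z 0 $$ (i, i) = c"
      using i by (simp_all add: X0 Z0)
    \<comment> \<open>Both sides satisfy s (k+2) = a * s (k+1) - (c - 1) * s k, so the induction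
      carries two consecutive values. At k = 0 both sides are a^2 - 2c.\<close>
    have "?a * X k $$ (i, i) - 2 * Z k $$ (i, i) = dickson (c - 1) (k + 2) ?a - dickson (c - 1) k ?a
      \<and> ?a * X (Suc k) $$ (i, i) - 2 * Z (Suc k) $$ (i, i) =
         dickson (c - 1) (Suc k + 2) ?a - dickson (c - 1) (Suc k) ?a" for k
    proof (induction k)
      case 0
      show ?case by (simp add: xS zS x0 z0 algebra_simps numeral_2_eq_2)
    next
      case (Suc k)
      have "?a * X (Suc (Suc k)) $$ (i, i) - 2 * Z (Suc (Suc k)) $$ (i, i) =
        ?a * (?a * X (Suc k) $$ (i, i) - 2 * Z (Suc k) $$ (i, i))
          - (c - 1) * (?a * X k $$ (i, i) - 2 * Z k $$ (i, i))"
        by (simp add: xS zS algebra_simps)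
      also have "\<dots> = ?a * (dickson (c - 1) (Suc k + 2) ?a - dickson (c - 1) (Suc k) ?a)
          - (c - 1) * (dickson (c - 1) (k + 2) ?a - dickson (c - 1) k ?a)"
        by (simp only: Suc.IH[THEN conjunct1] Suc.IH[THEN conjunct2])
      also have "\<dots> = dickson (c - 1) (Suc (Suc k) + 2) ?a - dickson (c - 1) (Suc (Suc k)) ?a"
        by (simp add: algebra_simps)
      finally show ?case using Suc.IH by blast
    qed
    then show ?thesis by blast
  qed
  have "mat_trace (A * X k) - 2 * mat_trace (Z k) =
      (\<Sum>i<n. A $$ (i, i) * X k $$ (i, i) - 2 * Z k $$ (i, i))"
    using A X[of k] Z[of k] utXZ[of k] index_mult_upper_triangular(2)[OF A utA X, of k]
    by (simp add: mat_trace_def sum_subtractf sum_distrib_left del: index_mult_mat(1))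
  then show ?thesis
    using rec diag by (simp add: A_def del: index_mult_mat(1))
qed

lemma sum_list_diag_mat:
  "sum_list (map f (diag_mat A)) = (\<Sum>i<dim_row A. f (A $$ (i, i)))"
  by (simp add: diag_mat_def sum_list_sum_nth atLeast0LessThan comp_def)

text \<open>
  Replacing \<open>S\<close> by \<open>S * P\<close> and \<open>T\<close> by \<open>Q * T\<close>, with \<open>Q\<close> the inverse of \<open>P\<close>, does not affect
  \<open>S * T\<close> and conjugates \<open>T * S\<close>, so that the latter may be taken to be triangular.
\<close>

lemma trace_pow_mat_eq_sum_dickson:
  fixes S T J :: "complex mat"
  assumes S: "S \<in> carrier_mat m n" and T: "T \<in> carrier_mat n m" and J: "J \<in> carrier_mat m m"
    and JJ: "J * J = 1\<^sub>m m" and TJS: "T * (J * S) = c \<cdot>\<^sub>m 1\<^sub>m n"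
    and ls: "char_poly (T * S) = (\<Prod>l\<leftarrow>ls. [:- l, 1:])"
  shows "length ls = n" and "mat_trace (T * S) = sum_list ls"
    and "mat_trace ((S * T - J) ^\<^sub>m k) = (\<Sum>l\<leftarrow>ls. dickson (c - 1) k l) +
      (if even k then of_nat m - 2 * of_nat n else - mat_trace J)"
proof -
  note assoc_mult_mat[simp del]
  have A: "T * S \<in> carrier_mat n n" using S T by simp
  obtain U P Q where sd: "schur_decomposition (T * S) ls = (U, P, Q)"
    using prod_cases3 by blast
  from schur_decomposition[OF A ls sd]
  have sim: "similar_mat_wit (T * S) U P Q" and ut: "upper_triangular U" and diag: "diag_mat U = ls"
    by auto
  from similar_mat_witD2[OF A sim]
  have PQ: "P * Q = 1\<^sub>m n" and QP: "Q * P = 1\<^sub>m n" and A_eq: "T * S = P * U * Q"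
    and U: "U \<in> carrier_mat n n" and P: "P \<in> carrier_mat n n" and Q: "Q \<in> carrier_mat n n"
    by auto
  show len: "length ls = n" using diag U by (auto simp: diag_mat_def)
  have SP: "S * P \<in> carrier_mat m n" and QT: "Q * T \<in> carrier_mat n m" and JS: "J * S \<in> carrier_mat m n"
    and PU: "P * U \<in> carrier_mat n n" and UQ: "U * Q \<in> carrier_mat n n"
    using S P Q T J U by auto
  have QTSP: "Q * T * (S * P) = U"
  proof -
    have "Q * T * (S * P) = Q * (T * S) * P"
      using assoc_mult_mat[OF QT S P] assoc_mult_mat[OF Q T S] by simp
    also have "\<dots> = Q * (P * (U * Q)) * P"
      unfolding A_eq assoc_mult_mat[OF P U Q] ..
    also have "\<dots> = U * Q * P"
      using assoc_mult_mat[OF Q P UQ] QP left_mult_one_mat[OF UQ] by simp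
    also have "\<dots> = U"
      using assoc_mult_mat[OF U Q P] QP U by simp
    finally show ?thesis .
  qed
  have B_eq: "S * P * (Q * T) = S * T"
  proof -
    have "S * P * (Q * T) = S * (P * (Q * T))" by (rule assoc_mult_mat[OF S P QT])
    also have "P * (Q * T) = T" using assoc_mult_mat[OF P Q T] PQ T by simp
    finally show ?thesis .
  qed
  have "Q * T * (J * (S * P)) = Q * T * (J * S * P)"
    unfolding assoc_mult_mat[OF J S P] ..
  also have "\<dots> = Q * (T * (J * S)) * P"
    using assoc_mult_mat[OF QT JS P] assoc_mult_mat[OF Q T JS] by simp
  also have "\<dots> = c \<cdot>\<^sub>m 1\<^sub>m n"
    unfolding TJS mult_smult_distrib[OF Q one_carrier_mat] right_mult_one_mat[OF Q]
      mult_smult_assoc_mat[OF Q P] QP ..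
  finally have TJS': "Q * T * (J * (S * P)) = c \<cdot>\<^sub>m 1\<^sub>m n" .
  \<comment> \<open>The deviation of the trace from the Dickson sum is the same at k and k + 2, so
    the values at 0 and 1 determine it.\<close>
  have period: "mat_trace ((S * T - J) ^\<^sub>m (k + 2)) - mat_trace ((S * T - J) ^\<^sub>m k) =
      (\<Sum>l\<leftarrow>ls. dickson (c - 1) (k + 2) l) - (\<Sum>l\<leftarrow>ls. dickson (c - 1) k l)" for k
    using trace_pow_mat_add_2[OF SP QT J JJ TJS', unfolded QTSP B_eq, OF ut, of k] U
    by (simp add: diag[symmetric] sum_list_diag_mat sum_subtractf)
  have "mat_trace (T * S) = mat_trace (S * P * (Q * T))"
    unfolding B_eq by (rule mat_trace_mult_commute[OF T S])
  also have "\<dots> = mat_trace U"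
    unfolding QTSP[symmetric] by (rule mat_trace_mult_commute[OF SP QT])
  also have "\<dots> = sum_list ls"
    using sum_list_diag_mat[of "\<lambda>x. x" U] by (simp add: diag mat_trace_def)
  finally show trA: "mat_trace (T * S) = sum_list ls" .
  have ST: "S * T - J \<in> carrier_mat m m" "S * T \<in> carrier_mat m m" using S T J by auto
  \<comment> \<open>The identity has trace m, and each of the n Dickson values at index 0 is
    2.\<close>
  have base0: "mat_trace ((S * T - J) ^\<^sub>m 0) = (\<Sum>l\<leftarrow>ls. dickson (c - 1) 0 l) + (of_nat m - 2 * of_nat n)"
  proof -
    have "mat_trace ((S * T - J) ^\<^sub>m 0) = mat_trace (1\<^sub>m m :: complex mat)"
      using J by simp
    then show ?thesis
      by (simp add: mat_trace_one sum_list_triv len)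
  qed
  have base1: "mat_trace ((S * T - J) ^\<^sub>m 1) = (\<Sum>l\<leftarrow>ls. dickson (c - 1) 1 l) - mat_trace J"
    using ST(1) trA mat_trace_minus[OF ST(2) J] mat_trace_mult_commute[OF S T] by simp
  show "mat_trace ((S * T - J) ^\<^sub>m k) = (\<Sum>l\<leftarrow>ls. dickson (c - 1) k l) +
      (if even k then of_nat m - 2 * of_nat n else - mat_trace J)"
  proof (induction k rule: nat_induct2)
    case 0
    then show ?case using base0 by simp
  next
    case 1
    then show ?case using base1 by simp
  next
    case (step k)
    have cancel: "a = c + r" if "a - b = c - d" "b = d + r" for a b c d r :: complex
      using that by (simp add: algebra_simps)
    show ?case
      using cancel[OF period step] by (simp only: even_add even_numeral simp_thms)
  qed
qed

subsection \<open>Matrices indexed by lists\<close>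

text \<open>Lets rows and columns be labelled by arcs or vertices, so that matrix identities become
  pointwise identities between functions of these labels.\<close>

definition kernel_mat :: "'a list \<Rightarrow> 'b list \<Rightarrow> ('a \<Rightarrow> 'b \<Rightarrow> 'c) \<Rightarrow> 'c mat" where
  "kernel_mat xs ys f = mat (length xs) (length ys) (\<lambda>(i, j). f (xs ! i) (ys ! j))"

lemma kernel_mat_carrier: "kernel_mat xs ys f \<in> carrier_mat (length xs) (length ys)"
  by (simp add: kernel_mat_def)

lemma kernel_mat_cong:
  assumes "\<And>x y. x \<in> set xs \<Longrightarrow> y \<in> set ys \<Longrightarrow> f x y = g x y"
  shows "kernel_mat xs ys f = kernel_mat xs ys g"
  using assms by (intro eq_matI) (auto simp: kernel_mat_def)

lemma sum_nth_distinct: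
  assumes "distinct xs"
  shows "(\<Sum>i<length xs. f (xs ! i)) = sum f (set xs)"
proof -
  have "sum f (set xs) = sum_list (map f xs)"
    using assms by (rule sum.distinct_set_conv_list)
  also have "\<dots> = (\<Sum>i<length xs. f (xs ! i))"
    by (simp add: sum_list_sum_nth atLeast0LessThan)
  finally show ?thesis by simp
qed

lemma kernel_mat_mult:
  fixes f :: "'a \<Rightarrow> 'b \<Rightarrow> 'c::semiring_0"
  assumes "distinct ys"
  shows "kernel_mat xs ys f * kernel_mat ys zs g = kernel_mat xs zs (\<lambda>x z. \<Sum>y\<in>set ys. f x y * g y z)"
  by (intro eq_matI)
    (auto simp: kernel_mat_def scalar_prod_def atLeast0LessThan sum_nth_distinct[OF assms, symmetric])

lemma kernel_mat_minus:
  "kernel_mat xs ys f - kernel_mat xs ys g = kernel_mat xs ys (\<lambda>x y. f x y - g x y)"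
  by (intro eq_matI) (auto simp: kernel_mat_def)

lemma smult_one_kernel_mat:
  fixes c :: "'c::semiring_1"
  assumes "distinct xs"
  shows "c \<cdot>\<^sub>m 1\<^sub>m (length xs) = kernel_mat xs xs (\<lambda>x y. if x = y then c else 0)"
  using assms by (intro eq_matI) (auto simp: kernel_mat_def nth_eq_iff_index_eq)

lemma mat_trace_kernel_mat:
  assumes "distinct xs"
  shows "mat_trace (kernel_mat xs xs f) = (\<Sum>x\<in>set xs. f x x)"
  by (simp add: mat_trace_def kernel_mat_def sum_nth_distinct[OF assms, symmetric])

text \<open>The transfer matrix method. The list \<open>p\<close> omits the end point
  \<open>y\<close>; taking \<open>hd\<close> of \<open>p @ [y]\<close> also covers k = 0, where it
  forces x = y.\<close>

lemma kernel_mat_pow: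
  assumes "distinct xs"
  shows "kernel_mat xs xs (\<lambda>x y. if R x y then 1 else 0 :: 'c::comm_semiring_1) ^\<^sub>m k =
    kernel_mat xs xs (\<lambda>x y. of_nat (card {p. set p \<subseteq> set xs \<and> length p = k \<and>
      hd (p @ [y]) = x \<and> successively R (p @ [y])}))"
    (is "?M ^\<^sub>m k = kernel_mat xs xs (\<lambda>x y. of_nat (card (?W k x y)))")
proof (induction k)
  case 0
  have "?M ^\<^sub>m 0 = 1 \<cdot>\<^sub>m 1\<^sub>m (length xs)"
    by (rule eq_matI) (simp_all add: kernel_mat_def)
  also have "\<dots> = kernel_mat xs xs (\<lambda>x y. if x = y then 1 else 0)"
    by (rule smult_one_kernel_mat[OF assms])
  also have "\<dots> = kernel_mat xs xs (\<lambda>x y. of_nat (card (?W 0 x y)))"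
  proof (rule kernel_mat_cong)
    fix x y
    have "?W 0 x y = (if x = y then {[]} else {})" by auto
    then show "(if x = y then 1 else 0) = of_nat (card (?W 0 x y))" by simp
  qed
  finally show ?case .
next
  case (Suc k)
  have "?M ^\<^sub>m Suc k = ?M * ?M ^\<^sub>m k"
    by (rule pow_mat_Suc_left[OF kernel_mat_carrier])
  also have "\<dots> = kernel_mat xs xs (\<lambda>x y. \<Sum>z\<in>set xs. (if R x z then 1 else 0) * of_nat (card (?W k z y)))"
    unfolding Suc by (rule kernel_mat_mult[OF assms])
  also have "\<dots> = kernel_mat xs xs (\<lambda>x y. of_nat (card (?W (Suc k) x y)))"
  proof (rule kernel_mat_cong)
    fix x y assume x: "x \<in> set xs" and y: "y \<in> set xs"
    have fin: "finite (?W k z y)" for z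
      by (rule finite_subset[OF _ finite_lists_length_eq[of "set xs" k]]) auto
    have inj: "inj_on ((#) x) A" for A
      by (simp add: inj_on_def)
    \<comment> \<open>Walks are split by their second point z. It may be the end point
      \<open>y\<close> itself, when k = 0.\<close>
    have W: "?W (Suc k) x y = (\<Union>z\<in>{z \<in> set xs. R x z}. (#) x ` ?W k z y)"
    proof (intro equalityI subsetI)
      fix p assume "p \<in> ?W (Suc k) x y"
      then obtain q where q: "p = x # q" "set q \<subseteq> set xs" "length q = k" "successively R (x # q @ [y])"
        by (cases p) auto
      have "hd (q @ [y]) \<in> set xs"
        using q y by (cases q) auto
      then show "p \<in> (\<Union>z\<in>{z \<in> set xs. R x z}. (#) x ` ?W k z y)"
        using q by (auto simp: successively_Cons)
    next
      fix p assume "p \<in> (\<Union>z\<in>{z \<in> set xs. R x z}. (#) x ` ?W k z y)"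
      then show "p \<in> ?W (Suc k) x y"
        using x by (auto simp: successively_Cons)
    qed
    have "card (?W (Suc k) x y) = (\<Sum>z\<in>{z \<in> set xs. R x z}. card ((#) x ` ?W k z y))"
      unfolding W using fin by (intro card_UN_disjoint) auto
    also have "\<dots> = (\<Sum>z\<in>{z \<in> set xs. R x z}. card (?W k z y))"
      by (simp only: card_image[OF inj])
    finally have card: "card (?W (Suc k) x y) = (\<Sum>z\<in>{z \<in> set xs. R x z}. card (?W k z y))" .
    show "(\<Sum>z\<in>set xs. (if R x z then 1 else 0) * of_nat (card (?W k z y))) =
        (of_nat (card (?W (Suc k) x y)) :: 'c)"
      unfolding card of_nat_sum sum.inter_filter[OF finite_set] by (auto intro!: sum.cong)
  qed
  finally show ?case .
qed

text \<open>A diagonal entry counts the walks returning to their start, and summing sorts closed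
  walks by first entry. Appending \<open>hd p\<close> makes the cyclic condition a linear
  one.\<close>

lemma mat_trace_kernel_mat_pow:
  assumes "distinct xs" "k \<ge> 1"
  shows "mat_trace (kernel_mat xs xs (\<lambda>x y. if R x y then 1 else 0 :: 'c::comm_semiring_1) ^\<^sub>m k) =
    of_nat (card {p. set p \<subseteq> set xs \<and> length p = k \<and> successively R (p @ [hd p])})"
proof -
  let ?C = "\<lambda>x. {p. set p \<subseteq> set xs \<and> length p = k \<and> hd (p @ [x]) = x \<and> successively R (p @ [x])}"
  have fin: "finite (?C x)" for x
    by (rule finite_subset[OF _ finite_lists_length_eq[of "set xs" k]]) auto
  have hd: "hd (p @ [x]) = hd p" if "length p = k" for p :: "'a list" and x
    using that assms(2) by (cases p) auto
  have "{p. set p \<subseteq> set xs \<and> length p = k \<and> successively R (p @ [hd p])} = (\<Union>x\<in>set xs. ?C x)"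
  proof (intro equalityI subsetI)
    fix p assume p: "p \<in> {p. set p \<subseteq> set xs \<and> length p = k \<and> successively R (p @ [hd p])}"
    then have "hd p \<in> set xs"
      using assms(2) by (cases p) auto
    then show "p \<in> (\<Union>x\<in>set xs. ?C x)"
      using p hd by (auto intro!: bexI[of _ "hd p"])
  qed (use hd in auto)
  also have "card \<dots> = (\<Sum>x\<in>set xs. card (?C x))"
    using fin hd by (intro card_UN_disjoint) auto
  finally show ?thesis
    by (simp add: kernel_mat_pow[OF assms(1)] mat_trace_kernel_mat[OF assms(1)])
qed

lemma sum_indicator_eq_card:
  assumes "finite A"
  shows "(\<Sum>x\<in>A. if P x then 1 else 0) = (of_nat (card {x \<in> A. P x}) :: 'a::semiring_1)"
  using sum.inter_filter[OF assms, of "\<lambda>_. 1 :: 'a" P] by simp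

lemma sum_delta_mult:
  fixes f :: "'a \<Rightarrow> 'b::semiring_1"
  assumes "finite A"
  shows "(\<Sum>y\<in>A. (if y = a then 1 else 0) * f y) = (if a \<in> A then f a else 0)"
proof -
  have "(\<Sum>y\<in>A. (if y = a then 1 else 0) * f y) = (\<Sum>y\<in>A. if y = a then f y else 0)"
    by (intro sum.cong) auto
  then show ?thesis
    using assms by simp
qed

subsection \<open>Non-backtracking walks\<close>

context finite_opp_graph
begin

definition successor :: "'e \<Rightarrow> 'e \<Rightarrow> bool" where
  "successor e f \<longleftrightarrow> head G e = tail G f \<and> f \<noteq> opp e"

lemma cas_iff_successively:
  "p \<noteq> [] \<Longrightarrow> cas u p v \<longleftrightarrow>
    tail G (hd p) = u \<and> head G (last p) = v \<and> successively (\<lambda>e f. head G e = tail G f) p"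
proof (induction p arbitrary: u)
  case (Cons e p)
  show ?case
  proof (cases "p = []")
    case False
    show ?thesis
      using False unfolding cas.simps Cons.IH[OF False] successively_Cons by auto
  qed auto
qed simp

text \<open>The step from the last arc to the appended copy of the first one is the closing
  condition; the base vertex is recovered as the tail of the first arc.\<close>

lemma closed_w_iff:
  "closed_w p \<longleftrightarrow> p \<noteq> [] \<and> set p \<subseteq> arcs G \<and> successively (\<lambda>e f. head G e = tail G f) (p @ [hd p])"
proof (cases "p = []")
  case False
  then have "tail G (hd p) \<in> verts G" if "set p \<subseteq> arcs G"
    using that by (cases p) auto
  then show ?thesis
    using False by (auto simp: closed_w_def awalk_def cas_iff_successively successively_append_iff)
qed (simp add: closed_w_def)

lemma strongly_irreducible_iff:
  "p \<noteq> [] \<Longrightarrow> strongly_irreducible opp p \<longleftrightarrow> successively (\<lambda>e f. f \<noteq> opp e) (p @ [hd p])"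
  by (auto simp: strongly_irreducible_def successively_append_iff successively_conv_nth[of _ p])

lemma opp_eq_self_imp_loop: "e \<in> arcs G \<Longrightarrow> opp e = e \<Longrightarrow> tail G e = head G e"
  using tail_opp[of e] by simp

text \<open>Since \<open>opp\<close> exchanges tail and head, a fixed arc is automatically a loop.
  Hence the trace of \<open>J\<close> counts half-loops.\<close>

lemma half_loops_eq: "half_loops G opp = {e \<in> arcs G. e = opp e}"
  using opp_eq_self_imp_loop by (auto simp: half_loops_def)

lemma strongly_irreducible_closed_w_iff:
  "closed_w p \<and> strongly_irreducible opp p \<longleftrightarrow>
    p \<noteq> [] \<and> set p \<subseteq> arcs G \<and> successively successor (p @ [hd p])"
proof (cases "p = []")
  case False
  then show ?thesis
    unfolding closed_w_iff strongly_irreducible_iff[OF False] successively_conv_nth successor_def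
    by blast
qed (simp add: closed_w_def)

text \<open>A half-loop is not its own \<open>successor\<close>, because it equals its reverse. The
  walks counted by convention are therefore disjoint from the others, and they occur only for k =
  1.\<close>

lemma SIT_eq_card_successively:
  assumes "k \<ge> 1"
  shows "SIT G opp k =
    card {p. set p \<subseteq> arcs G \<and> length p = k \<and> successively successor (p @ [hd p])} +
    (if k = 1 then card (half_loops G opp) else 0)"
proof -
  let ?W = "{p. set p \<subseteq> arcs G \<and> length p = k \<and> successively successor (p @ [hd p])}"
  let ?H = "{p. length p = k \<and> (\<exists>e\<in>half_loops G opp. p = [e])}"
  have loop: "closed_w [e]" if "e \<in> half_loops G opp" for e
    using that by (auto simp: closed_w_iff half_loops_def)
  have "{p. closed_w p \<and> length p = k \<and>
      (strongly_irreducible opp p \<or> (\<exists>e\<in>half_loops G opp. p = [e]))} =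
      {p. length p = k \<and> closed_w p \<and> strongly_irreducible opp p} \<union> ?H"
    using loop by blast
  also have "{p. length p = k \<and> closed_w p \<and> strongly_irreducible opp p} = ?W"
    unfolding strongly_irreducible_closed_w_iff using assms by auto
  finally have eq: "SIT G opp k = card (?W \<union> ?H)"
    by (simp add: SIT_def)
  have H: "?H = (if k = 1 then (\<lambda>e. [e]) ` half_loops G opp else {})"
    by auto
  have "finite ?W"
    by (rule finite_subset[OF _ finite_lists_length_eq[OF finite_arcs, of k]]) auto
  moreover have "finite ?H"
    unfolding H by (simp add: half_loops_def)
  moreover have "?W \<inter> ?H = {}"
    by (auto simp: successor_def half_loops_def)
  ultimately have "card (?W \<union> ?H) = card ?W + card ?H"
    by (rule card_Un_disjoint)
  moreover have "card ?H = (if k = 1 then card (half_loops G opp) else 0)"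
    unfolding H by (simp add: card_image inj_on_def)
  ultimately show ?thesis
    unfolding eq by simp
qed

section \<open>Arc matrices of a regular graph\<close>

lemma card_arcs_eq_sum_out_degree: "card (arcs G) = (\<Sum>v\<in>verts G. out_degree G v)"
proof -
  have "tail G ` arcs G \<subseteq> verts G" by auto
  from sum.group[OF finite_arcs finite_verts this, of "\<lambda>_. 1 :: nat"]
  show ?thesis
    by (simp add: out_degree_def out_arcs_def)
qed

text \<open>For odd k the trace formula contributes minus the number of half-loops. At k = 1 the
  counting convention cancels exactly this term; from k = 3 on it remains. The second claim is the
  trace of the adjacency matrix, which counts directed loops.\<close>

lemma SIT_eq_sum_dickson:
  assumes reg: "regular_graph d G" and vs: "distinct vs" "set vs = verts G"
    and ls: "eigenvalue_list (adjacency_matrix G vs) ls" and k: "k \<ge> 1"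
  shows "of_nat (SIT G opp k) = (\<Sum>l\<leftarrow>ls. dickson (of_nat d - 1) k l) +
      (if even k then of_nat (length ls) * (of_nat d - 2)
       else if k = 1 then 0 else - of_nat (card (half_loops G opp)))"
    and "sum_list ls = of_nat (card {e \<in> arcs G. head G e = tail G e})"
proof -
  obtain es where es: "distinct es" "set es = arcs G"
    using finite_distinct_list[OF finite_arcs] by blast
  define S :: "complex mat" where "S = kernel_mat es vs (\<lambda>e v. if v = head G e then 1 else 0)"
  define T :: "complex mat" where "T = kernel_mat vs es (\<lambda>v e. if v = tail G e then 1 else 0)"
  define J :: "complex mat" where "J = kernel_mat es es (\<lambda>e f. if f = opp e then 1 else 0)"
  have S: "S \<in> carrier_mat (length es) (length vs)" and T: "T \<in> carrier_mat (length vs) (length es)"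
    and J: "J \<in> carrier_mat (length es) (length es)"
    by (simp_all add: S_def T_def J_def kernel_mat_carrier)
  have JJ: "J * J = 1\<^sub>m (length es)"
  proof -
    have "J * J = kernel_mat es es (\<lambda>e f. if e = f then 1 else 0)"
      unfolding J_def kernel_mat_mult[OF es(1)]
      by (intro kernel_mat_cong) (auto simp: es sum_delta_mult opp_in_arcs opp_opp)
    also have "\<dots> = 1 \<cdot>\<^sub>m 1\<^sub>m (length es)"
      by (rule smult_one_kernel_mat[OF es(1), symmetric])
    also have "\<dots> = 1\<^sub>m (length es)"
      by (rule eq_matI) auto
    finally show ?thesis .
  qed
  have JS: "J * S = kernel_mat es vs (\<lambda>e v. if v = tail G e then 1 else 0)"
    unfolding J_def S_def kernel_mat_mult[OF es(1)]
    by (intro kernel_mat_cong) (auto simp: es sum_delta_mult opp_in_arcs head_opp)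
  \<comment> \<open>Both \<open>T\<close> and \<open>J * S\<close> record tails, so the product is
    the diagonal matrix of out-degrees.\<close>
  have TJS: "T * (J * S) = of_nat d \<cdot>\<^sub>m 1\<^sub>m (length vs)"
  proof -
    have "T * (J * S) = kernel_mat vs vs (\<lambda>u v. if u = v then of_nat d else 0)"
      unfolding JS T_def kernel_mat_mult[OF es(1)]
    proof (rule kernel_mat_cong)
      fix u v assume u: "u \<in> set vs"
      have "(\<Sum>e\<in>set es. (if u = tail G e then 1 else 0) * (if v = tail G e then 1 else 0)) =
          (\<Sum>e\<in>arcs G. if tail G e = u \<and> u = v then 1 else 0 :: complex)"
        unfolding es by (intro sum.cong) auto
      also have "\<dots> = of_nat (card {e \<in> arcs G. tail G e = u \<and> u = v})"
        by (rule sum_indicator_eq_card[OF finite_arcs])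
      also have "\<dots> = (if u = v then of_nat d else 0)"
        using reg u by (auto simp: vs regular_graph_def out_degree_def out_arcs_def)
      finally show "(\<Sum>e\<in>set es. (if u = tail G e then 1 else 0) * (if v = tail G e then 1 else 0)) =
          (if u = v then of_nat d else 0 :: complex)" .
    qed
    then show ?thesis
      by (simp only: smult_one_kernel_mat[OF vs(1)])
  qed
  have TS: "T * S = adjacency_matrix G vs"
  proof -
    have "T * S = kernel_mat vs vs (\<lambda>u v. of_nat (card {e \<in> arcs G. tail G e = u \<and> head G e = v}))"
      unfolding T_def S_def kernel_mat_mult[OF es(1)]
    proof (rule kernel_mat_cong)
      fix u v
      have "(\<Sum>e\<in>set es. (if u = tail G e then 1 else 0) * (if v = head G e then 1 else 0)) =
          (\<Sum>e\<in>arcs G. if tail G e = u \<and> head G e = v then 1 else 0 :: complex)"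
        unfolding es by (intro sum.cong) auto
      also have "\<dots> = of_nat (card {e \<in> arcs G. tail G e = u \<and> head G e = v})"
        by (rule sum_indicator_eq_card[OF finite_arcs])
      finally show "(\<Sum>e\<in>set es. (if u = tail G e then 1 else 0) * (if v = head G e then 1 else 0)) =
          (of_nat (card {e \<in> arcs G. tail G e = u \<and> head G e = v}) :: complex)" .
    qed
    then show ?thesis
      by (simp add: adjacency_matrix_def kernel_mat_def)
  qed
  have ST: "S * T = kernel_mat es es (\<lambda>e f. if head G e = tail G f then 1 else 0)"
    unfolding S_def T_def kernel_mat_mult[OF vs(1)]
    by (intro kernel_mat_cong) (auto simp: es vs sum_delta_mult)
  \<comment> \<open>The reverse of e starts at the head of e, so \<open>J\<close> removes only
    entries that are 1 in \<open>S * T\<close>.\<close>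
  have B: "S * T - J = kernel_mat es es (\<lambda>e f. if successor e f then 1 else 0)"
    unfolding ST J_def kernel_mat_minus
    by (intro kernel_mat_cong) (auto simp: es successor_def tail_opp)
  have trJ: "mat_trace J = of_nat (card (half_loops G opp))"
    unfolding J_def mat_trace_kernel_mat[OF es(1)] es sum_indicator_eq_card[OF finite_arcs]
      half_loops_eq ..
  have ls': "char_poly (T * S) = (\<Prod>l\<leftarrow>ls. [:- l, 1:])"
    using ls by (simp add: TS eigenvalue_list_def)
  note spectral = trace_pow_mat_eq_sum_dickson[OF S T J JJ TJS ls']
  \<comment> \<open>With m = n d arcs, the even deviation m - 2n becomes n (d - 2).\<close>
  have "of_nat (length es) = (of_nat (length ls * d) :: complex)"
  proof -
    have "length es = card (arcs G)"
      using es distinct_card by fastforce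
    also have "\<dots> = card (verts G) * d"
      using reg by (simp add: card_arcs_eq_sum_out_degree regular_graph_def)
    also have "card (verts G) = length ls"
      using vs distinct_card[OF vs(1)] spectral(1) by simp
    finally show ?thesis by simp
  qed
  then have m: "of_nat (length es) - 2 * of_nat (length vs) = (of_nat (length ls) * (of_nat d - 2) :: complex)"
    using spectral(1) by (simp add: algebra_simps)
  have "of_nat (SIT G opp k) = mat_trace ((S * T - J) ^\<^sub>m k) +
      (if k = 1 then of_nat (card (half_loops G opp)) else 0)"
    unfolding SIT_eq_card_successively[OF k] B mat_trace_kernel_mat_pow[OF es(1) k] es by simp
  then show "of_nat (SIT G opp k) = (\<Sum>l\<leftarrow>ls. dickson (of_nat d - 1) k l) +
      (if even k then of_nat (length ls) * (of_nat d - 2)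
       else if k = 1 then 0 else - of_nat (card (half_loops G opp)))"
    unfolding spectral(3) trJ m by auto
  have "sum_list ls = mat_trace (S * T)"
    using spectral(2) mat_trace_mult_commute[OF S T] by simp
  then show "sum_list ls = of_nat (card {e \<in> arcs G. head G e = tail G e})"
    unfolding ST mat_trace_kernel_mat[OF es(1)] es sum_indicator_eq_card[OF finite_arcs] .
qed

end

section \<open>From Dickson polynomials to \<open>q_tilde\<close> and \<open>q_hat\<close>\<close>

lemma q_tilde_eq_dickson:
  "q_tilde d k x = dickson (of_nat d - 1) k x + (if even k then of_nat d - 2 else 0)"
proof -
  \<comment> \<open>\<open>mu1\<close> and \<open>mu2\<close> are the roots of t^2 - x t + (d - 1).
    Only the square of \<open>csqrt\<close> enters their sum and product, so its branch is
    immaterial.\<close>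
  have s: "mu1 d x + mu2 d x = x"
    by (simp add: mu1_def mu2_def field_simps)
  have "mu1 d x * mu2 d x = (x\<^sup>2 - (csqrt (x\<^sup>2 - 4 * (of_nat d - 1)))\<^sup>2) / 4"
    by (simp add: mu1_def mu2_def field_simps power2_eq_square)
  also have "\<dots> = of_nat d - 1"
    by (simp add: diff_divide_distrib)
  finally have p: "mu1 d x * mu2 d x = of_nat d - 1" .
  show ?thesis
    using dickson_eq_power_sum[of "mu1 d x" "mu2 d x" k] unfolding s p q_tilde_def by simp
qed

theorem theorem10p3:
  fixes G :: "('v, 'e) pre_digraph" and opp :: "'e \<Rightarrow> 'e" and d :: nat
    and vs :: "'v list" and ls :: "complex list"
  assumes "3 \<le> d"
    and "finite_opp_graph G opp"
    and "regular_graph d G"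
    and "distinct vs" and "set vs = verts G"
    and "eigenvalue_list (adjacency_matrix G vs) ls"
  shows "(half_loops G opp = {} \<longrightarrow>
            (\<forall>k\<ge>1. of_nat (SIT G opp k) = (\<Sum>l\<leftarrow>ls. q_tilde d k l))) \<and>
         (whole_loop_arcs G opp = {} \<longrightarrow>
            (\<forall>k\<ge>1. of_nat (SIT G opp k) = (\<Sum>l\<leftarrow>ls. q_hat d k l)))"
proof (intro conjI impI allI)
  interpret finite_opp_graph G opp by fact
  note SIT = SIT_eq_sum_dickson(1)[OF assms(3-6)]
  have q_tilde: "(\<Sum>l\<leftarrow>ls. q_tilde d k l) = (\<Sum>l\<leftarrow>ls. dickson (of_nat d - 1) k l) +
      (if even k then of_nat (length ls) * (of_nat d - 2) else 0)" for k
    unfolding q_tilde_eq_dickson sum_list_addf sum_list_triv by simp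
  fix k :: nat
  assume k: "k \<ge> 1"
  show "of_nat (SIT G opp k) = (\<Sum>l\<leftarrow>ls. q_tilde d k l)" if "half_loops G opp = {}"
    unfolding q_tilde SIT[OF k] that by simp
  show "of_nat (SIT G opp k) = (\<Sum>l\<leftarrow>ls. q_hat d k l)" if "whole_loop_arcs G opp = {}"
  proof (cases "even k \<or> k = 1")
    case True
    then show ?thesis
      unfolding SIT[OF k] q_hat_def using q_tilde[of k] by auto
  next
    case False
    \<comment> \<open>Without whole-loops every loop is a half-loop, so the number of half-loops is
      the sum of the eigenvalues. Subtracting it amounts to the term -x of \<open>q_hat\<close> at
      each eigenvalue.\<close>
    have "{e \<in> arcs G. head G e = tail G e} = half_loops G opp"
      using that by (auto simp: whole_loop_arcs_def half_loops_def)
    then have "sum_list ls = of_nat (card (half_loops G opp))"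
      using SIT_eq_sum_dickson(2)[OF assms(3-6) k] by simp
    then show ?thesis
      unfolding SIT[OF k] q_hat_def using False q_tilde[of k] sum_list_subtractf[of "q_tilde d k" "\<lambda>l. l" ls]
      by simp
  qed
qed

end
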